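(* Let $S$ be a Garside family in a left-cancellative category $\mathcal{C}$ that admits unique local right-lcms (any two elements of $\mathcal{C}$ that admit a common right-multiple admit a unique right-lcm). (i) The algorithm Word Problem II described in the context solves the Word Problem of $\mathcal{C}$ with respect to $S$: for any two $S$-paths $u,v$ with the same source, it returns true if $u$ and $v$ represent the same element of $\mathcal{C}$, and false otherwise. (ii) If $S$ is finite, the complexity of this algorithm is quadratic in the length of the input paths.
   Context: Categories are viewed as monoids with a partial product: $fg$ is defined iff the target of $f$ is the source of $g$; $1_{\mathcal{C}}$ is the family of identity elements. $\mathcal{C}$ is left-cancellative if $fg=fg'$ implies $g=g'$. $f\preccurlyeq g$ ($g$ is a right-multiple of $f$) means $fg'=g$ for some $g'\in\mathcal{C}$. A right-lcm of $f,g$ is a common right-multiple $h$ such that every common right-multiple of $f,g$ is a right-multiple of $h$; when it is unique it is denoted $f\vee g$, and $f\backslash g$ is defined by $f\vee g=f(f\backslash g)$. $\mathcal{C}^\times$ is the family of invertible elements; $S^\sharp=S\mathcal{C}^\times\cup\mathcal{C}^\times$. A path $g_1|\cdots|g_p$ is $S$-normal if all entries lie in $S^\sharp$ and, for $i<p$, $a\in S$, $f\in\mathcal{C}$, $a\preccurlyeq fg_ig_{i+1}$ implies $a\preccurlyeq fg_i$; $S$ is a Garside family if every element of $\mathcal{C}$ is the product of an $S$-normal path. An $S$-path is a finite sequence of composable elements of $S$ (possibly an empty path $\varepsilon_x$). Signed paths may also contain formal inverses $\overline a$ (source and target exchanged) of entries $a$; $\overline{w_1|w_2}=\overline{w_2}|\overline{w_1}$.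 Identity elements $1_x$ are identified with empty paths $\varepsilon_x$. Word Problem II (input $u=b_1|\cdots|b_q$, $v=a_1|\cdots|a_p$ with the same source): let $\theta$ be the right-lcm selector on $S\cup 1_{\mathcal{C}}$, that is, $\theta(a,b)=a\backslash b$ whenever $a,b$ admit a right-lcm, undefined otherwise (its values lie in $S\cup 1_{\mathcal{C}}$). Right-reverse $\overline u|v$: put $b_{i,0}:=b_i$, $a_{0,j}:=a_j$; for $i=1,\dots,q$ and, for each $i$, for $j=1,\dots,p$: if $\theta(a_{i-1,j},b_{i,j-1})$ is defined, put $b_{i,j}:=\theta(a_{i-1,j},b_{i,j-1})$ and $a_{i,j}:=\theta(b_{i,j-1},a_{i-1,j})$; otherwise stop with result fail. If no failure occurs the result is $a_{q,1}|\cdots|a_{q,p}|\overline{b_{q,p}}|\cdots|\overline{b_{1,p}}$. Return true if the result is an empty path, and false otherwise (in particular if it is fail). Complexity counts evaluations of $\theta$ as unit cost. *)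

theory Defs
  imports Main
begin

section \<open>Categories as monoids with a partial product\<close>

text \<open>Composition is in diagrammatic order: \<open>f \<cdot> g\<close> is meaningful iff the target of \<open>f\<close> is the
  source of \<open>g\<close>.\<close>

record ('o, 'm) partial_monoid =
  Ob  :: "'o set"
  Mor :: "'m set"
  src :: "'m \<Rightarrow> 'o"
  trg :: "'m \<Rightarrow> 'o"
  idn :: "'o \<Rightarrow> 'm"
  cmp :: "'m \<Rightarrow> 'm \<Rightarrow> 'm" (infixl "\<cdot>\<index>" 70)

locale category =
  fixes C :: "('o, 'm) partial_monoid" (structure)
  assumes src_Ob: "f \<in> Mor C \<Longrightarrow> src C f \<in> Ob C"
    and trg_Ob: "f \<in> Mor C \<Longrightarrow> trg C f \<in> Ob C"
    and idn_Mor: "x \<in> Ob C \<Longrightarrow> idn C x \<in> Mor C"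
    and src_idn: "x \<in> Ob C \<Longrightarrow> src C (idn C x) = x"
    and trg_idn: "x \<in> Ob C \<Longrightarrow> trg C (idn C x) = x"
    and cmp_Mor: "\<lbrakk>f \<in> Mor C; g \<in> Mor C; trg C f = src C g\<rbrakk> \<Longrightarrow> f \<cdot> g \<in> Mor C"
    and src_cmp: "\<lbrakk>f \<in> Mor C; g \<in> Mor C; trg C f = src C g\<rbrakk> \<Longrightarrow> src C (f \<cdot> g) = src C f"
    and trg_cmp: "\<lbrakk>f \<in> Mor C; g \<in> Mor C; trg C f = src C g\<rbrakk> \<Longrightarrow> trg C (f \<cdot> g) = trg C g"
    and idn_cmp: "f \<in> Mor C \<Longrightarrow> idn C (src C f) \<cdot> f = f"
    and cmp_idn: "f \<in> Mor C \<Longrightarrow> f \<cdot> idn C (trg C f) = f"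
    and cmp_assoc: "\<lbrakk>f \<in> Mor C; g \<in> Mor C; h \<in> Mor C; trg C f = src C g; trg C g = src C h\<rbrakk>
      \<Longrightarrow> (f \<cdot> g) \<cdot> h = f \<cdot> (g \<cdot> h)"

locale left_cancellative_category = category +
  assumes left_cancel:
    "\<lbrakk>f \<in> Mor C; g \<in> Mor C; g' \<in> Mor C; trg C f = src C g; trg C f = src C g'; f \<cdot> g = f \<cdot> g'\<rbrakk>
      \<Longrightarrow> g = g'"

definition identities :: "('o, 'm) partial_monoid \<Rightarrow> 'm set" where
  "identities C = idn C ` Ob C"

definition invertibles :: "('o, 'm) partial_monoid \<Rightarrow> 'm set" where
  "invertibles C = {f \<in> Mor C. \<exists>g \<in> Mor C. src C g = trg C f \<and> trg C g = src C f \<and>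
     cmp C f g = idn C (src C f) \<and> cmp C g f = idn C (trg C f)}"

definition rmultiple :: "('o, 'm) partial_monoid \<Rightarrow> 'm \<Rightarrow> 'm \<Rightarrow> bool" (infix "\<preceq>\<index>" 50) where
  "f \<preceq>\<^bsub>C\<^esub> g \<longleftrightarrow> f \<in> Mor C \<and> (\<exists>g' \<in> Mor C. trg C f = src C g' \<and> cmp C f g' = g)"

definition is_right_lcm :: "('o, 'm) partial_monoid \<Rightarrow> 'm \<Rightarrow> 'm \<Rightarrow> 'm \<Rightarrow> bool" where
  "is_right_lcm C f g h \<longleftrightarrow>
     f \<preceq>\<^bsub>C\<^esub> h \<and> g \<preceq>\<^bsub>C\<^esub> h \<and> (\<forall>h'. f \<preceq>\<^bsub>C\<^esub> h' \<and> g \<preceq>\<^bsub>C\<^esub> h' \<longrightarrow> h \<preceq>\<^bsub>C\<^esub> h')"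

definition unique_local_right_lcms :: "('o, 'm) partial_monoid \<Rightarrow> bool" where
  "unique_local_right_lcms C \<longleftrightarrow>
     (\<forall>f \<in> Mor C. \<forall>g \<in> Mor C. (\<exists>h. f \<preceq>\<^bsub>C\<^esub> h \<and> g \<preceq>\<^bsub>C\<^esub> h) \<longrightarrow> (\<exists>!h. is_right_lcm C f g h))"

definition right_lcm :: "('o, 'm) partial_monoid \<Rightarrow> 'm \<Rightarrow> 'm \<Rightarrow> 'm" where
  "right_lcm C f g = (THE h. is_right_lcm C f g h)"

text \<open>The element \<open>f\g\<close> with \<open>f \<or> g = f (f\g)\<close>.\<close>

definition right_complement :: "('o, 'm) partial_monoid \<Rightarrow> 'm \<Rightarrow> 'm \<Rightarrow> 'm" where
  "right_complement C f g =
     (THE k. k \<in> Mor C \<and> trg C f = src C k \<and> right_lcm C f g = cmp C f k)"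


section \<open>Paths and Garside families\<close>

text \<open>A path is given by its source \<open>x\<close> and its list of entries, so that the empty list with
  source \<open>x\<close> is the empty path at \<open>x\<close>.\<close>

fun is_path :: "('o, 'm) partial_monoid \<Rightarrow> 'm set \<Rightarrow> 'o \<Rightarrow> 'm list \<Rightarrow> bool" where
  "is_path C A x [] \<longleftrightarrow> x \<in> Ob C"
| "is_path C A x (g # w) \<longleftrightarrow> g \<in> A \<and> g \<in> Mor C \<and> src C g = x \<and> is_path C A (trg C g) w"

fun path_prod :: "('o, 'm) partial_monoid \<Rightarrow> 'o \<Rightarrow> 'm list \<Rightarrow> 'm" where
  "path_prod C x [] = idn C x"
| "path_prod C x (g # w) = cmp C g (path_prod C (trg C g) w)"

definition sharp :: "('o, 'm) partial_monoid \<Rightarrow> 'm set \<Rightarrow> 'm set" where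
  "sharp C S = {cmp C s e | s e. s \<in> S \<and> e \<in> invertibles C \<and> trg C s = src C e} \<union> invertibles C"

definition normal_path :: "('o, 'm) partial_monoid \<Rightarrow> 'm set \<Rightarrow> 'o \<Rightarrow> 'm list \<Rightarrow> bool" where
  "normal_path C S x w \<longleftrightarrow> is_path C (sharp C S) x w \<and>
     (\<forall>i. Suc i < length w \<longrightarrow>
        (\<forall>a \<in> S. \<forall>f \<in> Mor C. trg C f = src C (w ! i) \<longrightarrow>
           a \<preceq>\<^bsub>C\<^esub> cmp C (cmp C f (w ! i)) (w ! Suc i) \<longrightarrow> a \<preceq>\<^bsub>C\<^esub> cmp C f (w ! i)))"

definition garside_family :: "('o, 'm) partial_monoid \<Rightarrow> 'm set \<Rightarrow> bool" where
  "garside_family C S \<longleftrightarrow> S \<subseteq> Mor C \<and>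
     (\<forall>g \<in> Mor C. \<exists>w. normal_path C S (src C g) w \<and> path_prod C (src C g) w = g)"


section \<open>The algorithm Word Problem II\<close>

definition theta :: "('o, 'm) partial_monoid \<Rightarrow> 'm set \<Rightarrow> 'm \<Rightarrow> 'm \<Rightarrow> 'm option" where
  "theta C S a b =
     (if a \<in> S \<union> identities C \<and> b \<in> S \<union> identities C \<and> (\<exists>h. is_right_lcm C a b h)
      then Some (right_complement C a b) else None)"

text \<open>A run of an algorithm yields a result (\<open>None\<close> standing for failure) together with the
  number of evaluations of the selector, which is the measure of complexity.\<close>

type_synonym 'r run = "'r option \<times> nat"

definition ret :: "'r \<Rightarrow> 'r run" where
  "ret r = (Some r, 0)"

fun and_then :: "'r run \<Rightarrow> ('r \<Rightarrow> 's run) \<Rightarrow> 's run" where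
  "and_then (None, n) k = (None, n)"
| "and_then (Some r, n) k = (fst (k r), n + snd (k r))"

definition query :: "('m \<Rightarrow> 'm \<Rightarrow> 'm option) \<Rightarrow> 'm \<Rightarrow> 'm \<Rightarrow> 'm run" where
  "query \<theta> a b = (\<theta> a b, 1)"

text \<open>The inner loop, for fixed \<open>i\<close>: from \<open>b = b\<^sub>i\<^sub>,\<^sub>0\<close> and the row \<open>a\<^sub>i\<^sub>-\<^sub>1\<^sub>,\<^sub>1, \<dots>, a\<^sub>i\<^sub>-\<^sub>1\<^sub>,\<^sub>p\<close> it computes
  \<open>b\<^sub>i\<^sub>,\<^sub>p\<close> and the row \<open>a\<^sub>i\<^sub>,\<^sub>1, \<dots>, a\<^sub>i\<^sub>,\<^sub>p\<close>.\<close>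

fun reverse_row :: "('m \<Rightarrow> 'm \<Rightarrow> 'm option) \<Rightarrow> 'm \<Rightarrow> 'm list \<Rightarrow> ('m \<times> 'm list) run" where
  "reverse_row \<theta> b [] = ret (b, [])"
| "reverse_row \<theta> b (a # as) =
     and_then (query \<theta> a b) (\<lambda>b'.
     and_then (query \<theta> b a) (\<lambda>a'.
     and_then (reverse_row \<theta> b' as) (\<lambda>(b'', as').
     ret (b'', a' # as'))))"

text \<open>The outer loop: from \<open>b\<^sub>1, \<dots>, b\<^sub>q\<close> and \<open>a\<^sub>1, \<dots>, a\<^sub>p\<close> it computes the last row
  \<open>a\<^sub>q\<^sub>,\<^sub>1, \<dots>, a\<^sub>q\<^sub>,\<^sub>p\<close> and the last column \<open>b\<^sub>1\<^sub>,\<^sub>p, \<dots>, b\<^sub>q\<^sub>,\<^sub>p\<close>.\<close>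

fun reverse_grid :: "('m \<Rightarrow> 'm \<Rightarrow> 'm option) \<Rightarrow> 'm list \<Rightarrow> 'm list \<Rightarrow> ('m list \<times> 'm list) run" where
  "reverse_grid \<theta> [] as = ret (as, [])"
| "reverse_grid \<theta> (b # bs) as =
     and_then (reverse_row \<theta> b as) (\<lambda>(b', as').
     and_then (reverse_grid \<theta> bs as') (\<lambda>(as'', bs').
     ret (as'', b' # bs')))"

datatype 'm letter = Pos (entry: 'm) | Neg (entry: 'm)

definition right_reverse :: "('m \<Rightarrow> 'm \<Rightarrow> 'm option) \<Rightarrow> 'm list \<Rightarrow> 'm list \<Rightarrow> 'm letter list run" where
  "right_reverse \<theta> u v =
     and_then (reverse_grid \<theta> u v) (\<lambda>(as, bs). ret (map Pos as @ map Neg (rev bs)))"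

text \<open>Identity elements are identified with empty paths, so a signed path is an empty path iff
  nothing is left once the identity entries are dropped.\<close>

definition drop_identities :: "('o, 'm) partial_monoid \<Rightarrow> 'm letter list \<Rightarrow> 'm letter list" where
  "drop_identities C w = filter (\<lambda>l. entry l \<notin> identities C) w"

definition word_problem_II ::
  "('o, 'm) partial_monoid \<Rightarrow> 'm set \<Rightarrow> 'm list \<Rightarrow> 'm list \<Rightarrow> bool" where
  "word_problem_II C S u v \<longleftrightarrow>
     (case fst (right_reverse (theta C S) u v) of
        None \<Rightarrow> False
      | Some w \<Rightarrow> drop_identities C w = [])"

definition word_problem_II_cost ::
  "('o, 'm) partial_monoid \<Rightarrow> 'm set \<Rightarrow> 'm list \<Rightarrow> 'm list \<Rightarrow> nat" where
  "word_problem_II_cost C S u v = snd (right_reverse (theta C S) u v)"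

end

theory Submission
  imports Defs
begin

text \<open>Write \<open>T\<close> for \<open>S\<close> together with the identities. Uniqueness of right-lcms leaves no room for
  invertible elements other than identities (\<open>invertibles_eq_identities\<close>): an invertible \<open>e\<close> and
  the identity at its source are both right-lcms of that identity with itself. So \<open>S\<^sup>\<sharp> = T\<close>,
  and divisibility is antisymmetric.

  The algorithm evaluates the selector only on pairs from \<open>T\<close>, so it must not leave \<open>T\<close>. The reason
  it does not is that every element \<open>g\<close> has a head, the first entry \<open>s \<in> T\<close> of a normal
  decomposition: every \<open>a \<in> T\<close> dividing \<open>f g\<close> divides already \<open>f s\<close>.
  If \<open>f g \<in> T\<close>, this for \<open>a = f g\<close> forces \<open>g = s\<close>, so \<open>T\<close> is closed under right factors. If \<open>h\<close> is
  the right-lcm of \<open>a, b \<in> T\<close>, then \<open>a\<close> and \<open>b\<close> divide the head of \<open>h\<close>, so \<open>h\<close> is its own head and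
  lies in \<open>T\<close>. Together, \<open>a\b \<in> T\<close>.

  Each successful step of the reversing is a commutative square whose diagonal is a right-lcm.
  Such squares paste along a common edge (\<open>lcm_square_paste\<close>), and a common right-multiple
  of the two outer sides can be pushed through a square (\<open>lcm_square_residual\<close>). Hence the grid
  succeeds exactly when the elements \<open>[u]\<close>, \<open>[v]\<close> represented by \<open>u\<close>, \<open>v\<close> have a common
  right-multiple, and then its remaining sides represent \<open>[u]\[v]\<close> and \<open>[v]\[u]\<close>. These two are
  identities iff \<open>[u] = [v]\<close>, and, as invertible elements are identities, a product is an identity
  iff all its factors are.

  As for the cost, a grid has at most \<open>|u| |v|\<close> cells, each with two evaluations of the selector.\<close>

section \<open>Divisibility and right-lcm squares\<close>

context category
begin

lemmas cat_simps [simp] =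
  src_Ob trg_Ob idn_Mor src_idn trg_idn cmp_Mor src_cmp trg_cmp idn_cmp cmp_idn

lemma rmultipleI:
  "\<lbrakk>f \<in> Mor C; g \<in> Mor C; trg C f = src C g\<rbrakk> \<Longrightarrow> f \<preceq> f \<cdot> g"
  by (auto simp: rmultiple_def)

lemma rmultipleE:
  assumes "f \<preceq> h"
  obtains g where "f \<in> Mor C" "g \<in> Mor C" "trg C f = src C g" "h = f \<cdot> g"
  using assms by (auto simp: rmultiple_def)

lemma rmultiple_Mor: "f \<preceq> h \<Longrightarrow> f \<in> Mor C \<and> h \<in> Mor C \<and> src C h = src C f"
  by (auto elim!: rmultipleE)

lemma rmultiple_refl: "f \<in> Mor C \<Longrightarrow> f \<preceq> f"
  using rmultipleI[of f "idn C (trg C f)"] by simp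

lemma rmultiple_trans:
  assumes "f \<preceq> g" "g \<preceq> h"
  shows "f \<preceq> h"
proof -
  obtain a where a: "f \<in> Mor C" "a \<in> Mor C" "trg C f = src C a" "g = f \<cdot> a"
    using assms(1) by (rule rmultipleE)
  obtain b where b: "b \<in> Mor C" "trg C g = src C b" "h = g \<cdot> b"
    using assms(2) by (rule rmultipleE)
  have "h = f \<cdot> (a \<cdot> b)"
    using a b by (simp add: cmp_assoc)
  then show ?thesis
    using a b rmultipleI[of f "a \<cdot> b"] by simp
qed

lemma idn_rmultiple: "f \<in> Mor C \<Longrightarrow> idn C (src C f) \<preceq> f"
  using rmultipleI[of "idn C (src C f)" f] by simp

lemma identitiesD: "e \<in> identities C \<Longrightarrow> e \<in> Mor C \<and> idn C (src C e) = e \<and> trg C e = src C e"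
  by (auto simp: identities_def)

lemma idn_in_identities: "x \<in> Ob C \<Longrightarrow> idn C x \<in> identities C"
  by (auto simp: identities_def)

lemma is_right_lcm_commute: "is_right_lcm C f g h \<longleftrightarrow> is_right_lcm C g f h"
  by (auto simp: is_right_lcm_def)

text \<open>The cell of the reversing grid: \<open>f\<close> on the left, \<open>g\<close> on top, \<open>f'\<close> on the right and \<open>g'\<close> at
  the bottom, so that \<open>f'\<close> is \<open>g\f\<close> and \<open>g'\<close> is \<open>f\g\<close>. As a relation it needs no selector,
  which lets the sides be arbitrary elements, in particular products of paths.\<close>

definition lcm_square :: "'m \<Rightarrow> 'm \<Rightarrow> 'm \<Rightarrow> 'm \<Rightarrow> bool" where
  "lcm_square f g f' g' \<longleftrightarrow>
     f \<in> Mor C \<and> g \<in> Mor C \<and> f' \<in> Mor C \<and> g' \<in> Mor C \<and>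
     trg C f = src C g' \<and> trg C g = src C f' \<and> f \<cdot> g' = g \<cdot> f' \<and> is_right_lcm C f g (f \<cdot> g')"

lemma lcm_square_src: "lcm_square f g f' g' \<Longrightarrow> src C f = src C g"
  unfolding lcm_square_def by (metis src_cmp)

lemma lcm_square_trg: "lcm_square f g f' g' \<Longrightarrow> trg C f' = trg C g'"
  unfolding lcm_square_def by (metis trg_cmp)

lemma lcm_square_commute: "lcm_square f g f' g' \<longleftrightarrow> lcm_square g f g' f'"
  unfolding lcm_square_def by (metis is_right_lcm_commute)

lemma lcm_square_idn:
  assumes "f \<in> Mor C"
  shows "lcm_square f (idn C (src C f)) f (idn C (trg C f))"
  using assms by (simp add: lcm_square_def is_right_lcm_def rmultiple_refl idn_rmultiple)

end

context left_cancellative_category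
begin

lemma right_inverse_imp_invertible:
  assumes "f \<in> Mor C" "g \<in> Mor C" "trg C f = src C g" "f \<cdot> g = idn C (src C f)"
  shows "f \<in> invertibles C \<and> g \<in> invertibles C"
proof -
  have trg: "trg C g = src C f"
    using assms by (metis trg_cmp trg_idn src_Ob)
  have "f \<cdot> (g \<cdot> f) = f \<cdot> idn C (trg C f)"
    using assms trg cmp_idn[of f] by (simp add: cmp_assoc [symmetric])
  then have "g \<cdot> f = idn C (trg C f)"
    using assms trg by (metis left_cancel cmp_Mor idn_Mor trg_Ob src_cmp src_idn)
  with assms trg show ?thesis
    unfolding invertibles_def by auto
qed

text \<open>A failure deeper in the grid must be a failure of the whole grid. For that, common
  right-multiples have to travel inwards: the diagonal \<open>g f'\<close> divides \<open>h\<close>, and cancelling \<open>g\<close>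
  leaves a common right-multiple of the right side and of what remains of the top.\<close>

lemma lcm_square_residual:
  assumes sq: "lcm_square f g f' g'"
    and g2: "g2 \<in> Mor C" "trg C g = src C g2"
    and h: "f \<preceq> h" "g \<cdot> g2 \<preceq> h"
  obtains k where "f' \<preceq> k" "g2 \<preceq> k" "h = g \<cdot> k"
proof -
  have sqD: "f \<in> Mor C" "g \<in> Mor C" "f' \<in> Mor C" "g' \<in> Mor C"
    "trg C f = src C g'" "trg C g = src C f'" "f \<cdot> g' = g \<cdot> f'" "is_right_lcm C f g (f \<cdot> g')"
    using sq unfolding lcm_square_def by blast+
  obtain y where y: "y \<in> Mor C" "trg C (g \<cdot> g2) = src C y" "h = (g \<cdot> g2) \<cdot> y"
    using h(2) by (rule rmultipleE)
  have hy: "h = g \<cdot> (g2 \<cdot> y)"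
    using y g2 sqD by (simp add: cmp_assoc)
  have "g \<preceq> h"
    unfolding hy using y g2 sqD by (intro rmultipleI) simp_all
  then have "g \<cdot> f' \<preceq> h"
    using sqD(7,8) h(1) by (simp add: is_right_lcm_def)
  then obtain z where z: "z \<in> Mor C" "trg C (g \<cdot> f') = src C z" "h = (g \<cdot> f') \<cdot> z"
    by (rule rmultipleE)
  have hz: "h = g \<cdot> (f' \<cdot> z)"
    using z sqD by (simp add: cmp_assoc)
  have "g2 \<cdot> y = f' \<cdot> z"
  proof (rule left_cancel[of g])
    show "g \<cdot> (g2 \<cdot> y) = g \<cdot> (f' \<cdot> z)"
      using hy hz by metis
  qed (use y(1,2) z(1,2) g2 sqD(1-6) in simp_all)
  then have "g2 \<preceq> f' \<cdot> z"
    using rmultipleI[of g2 y] y g2 sqD by simp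
  moreover have "f' \<preceq> f' \<cdot> z"
    using z sqD by (intro rmultipleI) simp_all
  ultimately show thesis
    using hz that by blast
qed

lemma lcm_square_paste:
  assumes sq1: "lcm_square f g1 f' g1'" and sq2: "lcm_square f' g2 f'' g2'"
  shows "lcm_square f (g1 \<cdot> g2) f'' (g1' \<cdot> g2')"
proof -
  have D1: "f \<in> Mor C" "g1 \<in> Mor C" "f' \<in> Mor C" "g1' \<in> Mor C"
    "trg C f = src C g1'" "trg C g1 = src C f'" "f \<cdot> g1' = g1 \<cdot> f'"
    using sq1 unfolding lcm_square_def by blast+
  have D2: "g2 \<in> Mor C" "f'' \<in> Mor C" "g2' \<in> Mor C"
    "trg C f' = src C g2'" "trg C g2 = src C f''" "f' \<cdot> g2' = g2 \<cdot> f''"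
    "is_right_lcm C f' g2 (f' \<cdot> g2')"
    using sq2 unfolding lcm_square_def by blast+
  have src: "src C g2 = src C f'" "trg C g1' = src C g2'"
    using lcm_square_src[OF sq2] lcm_square_trg[OF sq1] D2 by simp_all
  have "f \<cdot> (g1' \<cdot> g2') = (f \<cdot> g1') \<cdot> g2'"
    using D1(1-6) D2(1-5) src by (simp add: cmp_assoc)
  also have "\<dots> = g1 \<cdot> (f' \<cdot> g2')"
    unfolding D1(7) using D1(1-6) D2(1-5) src by (simp add: cmp_assoc)
  finally have diag: "f \<cdot> (g1' \<cdot> g2') = g1 \<cdot> (f' \<cdot> g2')" .
  have comm: "g1 \<cdot> (f' \<cdot> g2') = (g1 \<cdot> g2) \<cdot> f''"
    unfolding D2(6) using D1(1-6) D2(1-5) src by (simp add: cmp_assoc)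
  have "f \<cdot> (g1' \<cdot> g2') \<preceq> h" if h: "f \<preceq> h" "g1 \<cdot> g2 \<preceq> h" for h
  proof -
    obtain k where k: "f' \<preceq> k" "g2 \<preceq> k" "h = g1 \<cdot> k"
      using lcm_square_residual[OF sq1 _ _ h] D1 D2 src by auto
    then have "f' \<cdot> g2' \<preceq> k"
      using D2 by (simp add: is_right_lcm_def)
    then obtain t where t: "t \<in> Mor C" "trg C (f' \<cdot> g2') = src C t" "k = (f' \<cdot> g2') \<cdot> t"
      by (rule rmultipleE)
    have "h = (g1 \<cdot> (f' \<cdot> g2')) \<cdot> t"
      unfolding k(3) t(3) using t(1,2) D1(1-6) D2(1-5) src by (simp add: cmp_assoc)
    then show ?thesis
      unfolding diag using rmultipleI[of "g1 \<cdot> (f' \<cdot> g2')" t] t(1,2) D1(1-6) D2(1-5) src by simp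
  qed
  moreover have "f \<preceq> f \<cdot> (g1' \<cdot> g2')"
    using D1(1-6) D2(1-5) src by (intro rmultipleI) simp_all
  moreover have "g1 \<cdot> g2 \<preceq> f \<cdot> (g1' \<cdot> g2')"
    unfolding diag comm using D1(1-6) D2(1-5) src by (intro rmultipleI) simp_all
  moreover have "g1 \<cdot> g2 \<in> Mor C" "g1' \<cdot> g2' \<in> Mor C"
    "trg C f = src C (g1' \<cdot> g2')" "trg C (g1 \<cdot> g2) = src C f''"
    using D1(1-6) D2(1-5) src by simp_all
  ultimately show ?thesis
    unfolding lcm_square_def is_right_lcm_def
    using D1(1) D2(2) trans[OF diag comm] by blast
qed

end

section \<open>Paths\<close>

context category
begin

lemma is_path_mono: "is_path C A x w \<Longrightarrow> A \<subseteq> B \<Longrightarrow> is_path C B x w"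
  by (induction w arbitrary: x) auto

lemma path_prod_Mor: "is_path C A x w \<Longrightarrow> path_prod C x w \<in> Mor C \<and> src C (path_prod C x w) = x"
  by (induction w arbitrary: x) auto

lemma path_prod_identities:
  "is_path C A x w \<Longrightarrow> set w \<subseteq> identities C \<Longrightarrow> path_prod C x w = idn C x"
proof (induction w arbitrary: x)
  case (Cons g w)
  then have "g = idn C x" "trg C g = x" "x \<in> Ob C"
    using identitiesD[of g] src_Ob[of g] by auto
  then show ?case
    using Cons idn_cmp[of "idn C x"] by simp
qed simp

lemma normal_path_tl: "normal_path C S x (g # w) \<Longrightarrow> normal_path C S (trg C g) w"
  unfolding normal_path_def by fastforce

text \<open>The defining condition of normality links two adjacent entries; the arbitrary left factor
  \<open>f\<close> in it, which can absorb entries already passed, is what propagates it to the whole path.\<close>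

lemma normal_path_head:
  assumes "normal_path C S x (g # w)" "a \<in> S" "f \<in> Mor C" "trg C f = x"
    and "a \<preceq> f \<cdot> path_prod C x (g # w)"
  shows "a \<preceq> f \<cdot> g"
  using assms
proof (induction w arbitrary: x f g)
  case Nil
  have "is_path C (sharp C S) x [g]"
    using Nil.prems(1) unfolding normal_path_def by blast
  then show ?case
    using Nil.prems(5) by simp
next
  case (Cons g' w)
  have path: "is_path C (sharp C S) x (g # g' # w)"
    using Cons.prems(1) unfolding normal_path_def by blast
  then have g: "g \<in> Mor C" "src C g = x" "is_path C (sharp C S) (trg C g) (g' # w)"
    by simp_all
  have adjacent: "\<forall>a\<in>S. \<forall>f\<in>Mor C. trg C f = src C g \<longrightarrow> a \<preceq> f \<cdot> g \<cdot> g' \<longrightarrow> a \<preceq> f \<cdot> g"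
    using spec[OF conjunct2[OF Cons.prems(1)[unfolded normal_path_def]], of 0]
    unfolding nth_Cons_0 nth_Cons_Suc by (simp only: length_Cons zero_less_Suc Suc_less_eq simp_thms)
  have "a \<preceq> (f \<cdot> g) \<cdot> path_prod C (trg C g) (g' # w)"
    using Cons.prems(2-5) g path_prod_Mor[OF g(3)] by (simp add: cmp_assoc)
  then have "a \<preceq> (f \<cdot> g) \<cdot> g'"
    using Cons.IH[OF normal_path_tl[OF Cons.prems(1)], of "f \<cdot> g"] Cons.prems g by simp
  then show ?case
    using adjacent Cons.prems(2-4) g(2) by simp
qed

end

section \<open>Closure properties of the Garside family\<close>

locale lcm_garside = left_cancellative_category C
  for C :: "('o, 'm) partial_monoid" (structure) +
  fixes S :: "'m set"
  assumes garside: "garside_family C S"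
    and unique_lcms: "unique_local_right_lcms C"
begin

definition T :: "'m set" where
  "T = S \<union> identities C"

lemma invertibles_eq_identities: "invertibles C = identities C"
proof
  show "invertibles C \<subseteq> identities C"
  proof
    fix e assume "e \<in> invertibles C"
    then obtain e' where e: "e \<in> Mor C" "e' \<in> Mor C" "src C e' = trg C e" "trg C e' = src C e"
      "e \<cdot> e' = idn C (src C e)"
      unfolding invertibles_def by auto
    let ?i = "idn C (src C e)"
    have i: "?i \<in> Mor C" using e by simp
    have "e \<preceq> h" if "?i \<preceq> h" for h
    proof -
      have h: "h \<in> Mor C" "src C h = src C e"
        using rmultiple_Mor[OF that] e by simp_all
      then have "h = (e \<cdot> e') \<cdot> h"
        using e idn_cmp[of h] by simp
      also have "\<dots> = e \<cdot> (e' \<cdot> h)"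
        using h e by (intro cmp_assoc) simp_all
      finally have "e \<cdot> (e' \<cdot> h) = h" ..
      then show ?thesis
        using rmultipleI[of e "e' \<cdot> h"] h e by simp
    qed
    then have "is_right_lcm C ?i ?i e"
      using e idn_rmultiple by (simp add: is_right_lcm_def)
    moreover have "is_right_lcm C ?i ?i ?i"
      using i by (simp add: is_right_lcm_def rmultiple_refl)
    moreover have "\<exists>!h. is_right_lcm C ?i ?i h"
      using unique_lcms[unfolded unique_local_right_lcms_def, rule_format, OF i i]
        rmultiple_refl[OF i] by metis
    ultimately have "e = ?i" by metis
    then show "e \<in> identities C"
      using e idn_in_identities[of "src C e"] by (metis src_Ob)
  qed
  show "identities C \<subseteq> invertibles C"
  proof
    fix e assume "e \<in> identities C"
    then have "e \<in> Mor C" "trg C e = src C e" "idn C (src C e) = e"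
      using identitiesD[of e] by simp_all
    then show "e \<in> invertibles C"
      using right_inverse_imp_invertible[of e e] idn_cmp[of e] by simp
  qed
qed

lemma cmp_eq_idn:
  assumes "f \<in> Mor C" "g \<in> Mor C" "trg C f = src C g" "f \<cdot> g = idn C (src C f)"
  shows "f \<in> identities C \<and> g \<in> identities C"
  using right_inverse_imp_invertible[OF assms] unfolding invertibles_eq_identities .

lemma rmultiple_antisym:
  assumes "f \<preceq> g" "g \<preceq> f"
  shows "f = g"
proof -
  obtain a where a: "f \<in> Mor C" "a \<in> Mor C" "trg C f = src C a" "g = f \<cdot> a"
    using assms(1) by (rule rmultipleE)
  obtain b where b: "b \<in> Mor C" "trg C g = src C b" "f = g \<cdot> b"
    using assms(2) by (rule rmultipleE)
  have ab: "trg C a = src C b"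
    using a b(2) by (metis trg_cmp)
  have "f \<cdot> (a \<cdot> b) = (f \<cdot> a) \<cdot> b"
    using a(1-3) b(1) ab by (simp add: cmp_assoc)
  also have "\<dots> = f \<cdot> idn C (trg C f)"
    using a(1,4) b(3) cmp_idn by metis
  finally have eq: "f \<cdot> (a \<cdot> b) = f \<cdot> idn C (trg C f)" .
  have "a \<cdot> b = idn C (src C a)"
    using left_cancel[of f "a \<cdot> b" "idn C (trg C f)"] a(1-3) b(1) ab eq by simp
  then have "a \<in> identities C"
    using cmp_eq_idn a b(1) ab by blast
  then have "a = idn C (trg C f)"
    using identitiesD a(3) by metis
  then show ?thesis
    using a(1,4) by simp
qed

lemma T_Mor: "a \<in> T \<Longrightarrow> a \<in> Mor C"
  using conjunct1[OF garside[unfolded garside_family_def]] identitiesD[of a]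
  unfolding T_def by blast

lemma idn_T: "x \<in> Ob C \<Longrightarrow> idn C x \<in> T"
  by (simp add: T_def idn_in_identities)

lemma sharp_eq_T: "sharp C S = T"
proof -
  have Mor: "s \<in> Mor C" if "s \<in> S" for s
    using that T_Mor by (simp add: T_def)
  have "s \<cdot> e = s" if "s \<in> S" "e \<in> identities C" "trg C s = src C e" for s e
    using that Mor identitiesD[of e] cmp_idn[of s] by simp
  moreover have "\<exists>e \<in> identities C. s = s \<cdot> e \<and> trg C s = src C e" if "s \<in> S" for s
    using Mor[OF that] by (intro bexI[of _ "idn C (trg C s)"]) (simp_all add: idn_in_identities)
  ultimately have "{s \<cdot> e | s e. s \<in> S \<and> e \<in> identities C \<and> trg C s = src C e} = S"
    by (auto, metis)
  then show ?thesis
    unfolding sharp_def T_def invertibles_eq_identities by simp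
qed

text \<open>The factor \<open>f\<close> in front is essential for \<open>T_right_factor\<close>, where the element whose head is
  taken is only a right factor of the divisor considered.\<close>

lemma head_exists:
  assumes g: "g \<in> Mor C"
  obtains s where "s \<in> T" "s \<preceq> g"
    "\<And>a f. \<lbrakk>a \<in> T; f \<in> Mor C; trg C f = src C g; a \<preceq> f \<cdot> g\<rbrakk> \<Longrightarrow> a \<preceq> f \<cdot> s"
proof -
  obtain w where w: "normal_path C S (src C g) w" "path_prod C (src C g) w = g"
    using garside g unfolding garside_family_def by blast
  \<comment> \<open>An identity, the value of the empty path, is its own head.\<close>
  define s where "s = (case w of [] \<Rightarrow> g | s # _ \<Rightarrow> s)"
  have path: "is_path C T (src C g) w"
    using w(1) unfolding normal_path_def sharp_eq_T by blast
  have s: "s \<in> T" "s \<preceq> g"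
  proof -
    show "s \<in> T"
      using path w(2) idn_T[of "src C g"] by (cases w) (simp_all add: s_def)
    show "s \<preceq> g"
    proof (cases w)
      case Nil
      then show ?thesis using g by (simp add: s_def rmultiple_refl)
    next
      case (Cons t w')
      then have "t \<preceq> t \<cdot> path_prod C (trg C t) w'"
        using path path_prod_Mor[of T "trg C t" w'] by (intro rmultipleI) auto
      then show ?thesis using Cons w(2) by (simp add: s_def)
    qed
  qed
  have "a \<preceq> f \<cdot> s" if a: "a \<in> T" "f \<in> Mor C" "trg C f = src C g" "a \<preceq> f \<cdot> g" for a f
  proof (cases "a \<in> S")
    case True
    then show ?thesis
      using a w normal_path_head[of S "src C g" _ _ a f] by (cases w) (auto simp: s_def)
  next
    case False
    then have id: "a \<in> identities C"
      using a(1) by (simp add: T_def)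
    have comp: "f \<cdot> s \<in> Mor C" "src C (f \<cdot> s) = src C f"
      using a(2,3) rmultiple_Mor[OF s(2)] by simp_all
    have "src C a = src C f"
      using rmultiple_Mor[OF a(4)] a g by simp
    then have "a = idn C (src C (f \<cdot> s))"
      using identitiesD[OF id] comp by metis
    then show ?thesis
      using idn_rmultiple[OF comp(1)] by simp
  qed
  with s that show thesis by blast
qed

lemma T_right_factor:
  assumes "f \<in> Mor C" "g \<in> Mor C" "trg C f = src C g" "f \<cdot> g \<in> T"
  shows "g \<in> T"
proof -
  obtain s where s: "s \<in> T" "s \<preceq> g"
    "\<And>a f. \<lbrakk>a \<in> T; f \<in> Mor C; trg C f = src C g; a \<preceq> f \<cdot> g\<rbrakk> \<Longrightarrow> a \<preceq> f \<cdot> s"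
    using head_exists[OF assms(2)] by blast
  obtain t where t: "s \<in> Mor C" "t \<in> Mor C" "trg C s = src C t" "g = s \<cdot> t"
    using s(2) by (rule rmultipleE)
  have "f \<cdot> g \<preceq> f \<cdot> s"
    using s(3) assms by (simp add: rmultiple_refl)
  moreover have "f \<cdot> s \<preceq> f \<cdot> g"
    using rmultipleI[of "f \<cdot> s" t] assms t by (simp add: cmp_assoc)
  ultimately have "f \<cdot> g = f \<cdot> s"
    by (rule rmultiple_antisym)
  then have "g = s"
    using left_cancel[of f g s] assms t by simp
  with s show ?thesis by simp
qed

lemma T_right_lcm:
  assumes "a \<in> T" "b \<in> T" "is_right_lcm C a b h"
  shows "h \<in> T"
proof -
  have h: "a \<preceq> h" "b \<preceq> h" "\<And>k. a \<preceq> k \<Longrightarrow> b \<preceq> k \<Longrightarrow> h \<preceq> k"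
    using assms(3) by (auto simp: is_right_lcm_def)
  then have hM: "h \<in> Mor C"
    using rmultiple_Mor by blast
  obtain s where s: "s \<in> T" "s \<preceq> h"
    "\<And>a f. \<lbrakk>a \<in> T; f \<in> Mor C; trg C f = src C h; a \<preceq> f \<cdot> h\<rbrakk> \<Longrightarrow> a \<preceq> f \<cdot> s"
    using head_exists[OF hM] by blast
  have "c \<preceq> s" if "c \<in> T" "c \<preceq> h" for c
    using s(3)[of c "idn C (src C h)"] that hM T_Mor[OF s(1)] rmultiple_Mor[OF s(2)]
      idn_cmp[of h] idn_cmp[of s] by simp
  then have "h \<preceq> s"
    using h assms by blast
  then have "h = s"
    using s(2) by (rule rmultiple_antisym)
  with s show ?thesis by simp
qed

section \<open>Correctness of the reversing grid\<close>

lemma ex_right_lcm: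
  "a \<preceq> h \<Longrightarrow> b \<preceq> h \<Longrightarrow> \<exists>!k. is_right_lcm C a b k"
  using unique_lcms rmultiple_Mor[of a h] rmultiple_Mor[of b h]
  unfolding unique_local_right_lcms_def by blast

lemma right_lcm_eqI:
  assumes "is_right_lcm C a b h"
  shows "right_lcm C a b = h"
  unfolding right_lcm_def
proof (rule the1_equality)
  show "\<exists>!k. is_right_lcm C a b k"
    using assms ex_right_lcm[of a h b] by (simp add: is_right_lcm_def)
qed (rule assms)

lemma right_complement_eqI:
  assumes "is_right_lcm C a b (a \<cdot> c)" "a \<in> Mor C" "c \<in> Mor C" "trg C a = src C c"
  shows "right_complement C a b = c"
  unfolding right_complement_def right_lcm_eqI[OF assms(1)]
  using assms left_cancel[of a] by (intro the_equality) auto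

text \<open>The two evaluations of the selector made in one cell succeed or fail together.\<close>

lemma theta_None:
  assumes "a \<in> T" "b \<in> T" "theta C S a b = None"
  shows "\<not> (\<exists>h. b \<preceq> h \<and> a \<preceq> h)"
  using assms ex_right_lcm[of a _ b] unfolding theta_def T_def by (auto split: if_splits)

lemma theta_Some:
  assumes "a \<in> T" "b \<in> T" "theta C S a b = Some b'"
  obtains a' where "theta C S b a = Some a'" "a' \<in> T" "b' \<in> T" "lcm_square b a b' a'"
proof -
  have D: "\<exists>h. is_right_lcm C a b h" "b' = right_complement C a b"
    using assms(3) by (auto simp: theta_def split: if_splits)
  then obtain h where h: "is_right_lcm C a b h" by blast
  have "a \<preceq> h" "b \<preceq> h"
    using h by (simp_all add: is_right_lcm_def)
  then obtain c d where c: "a \<in> Mor C" "c \<in> Mor C" "trg C a = src C c" "h = a \<cdot> c"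
    and d: "b \<in> Mor C" "d \<in> Mor C" "trg C b = src C d" "h = b \<cdot> d"
    by (metis rmultipleE)
  have h': "is_right_lcm C b a h"
    using h is_right_lcm_commute by simp
  have "b' = c"
    using D(2) right_complement_eqI[of a b c] h c by simp
  moreover have "theta C S b a = Some d"
    using assms(1,2) h' right_complement_eqI[of b a d] d
    unfolding theta_def T_def by auto
  moreover have "c \<in> T"
    using T_right_factor[of a c] T_right_lcm[OF assms(1,2) h] c by simp
  moreover have "d \<in> T"
    using T_right_factor[of b d] T_right_lcm[OF assms(1,2) h] d by simp
  moreover have "lcm_square b a c d"
    unfolding lcm_square_def using c d h' by simp
  ultimately show thesis
    using that by blast
qed

text \<open>A row is an induction along its top side: success pastes one more square on the left, and on
  failure \<open>lcm_square_residual\<close> contradicts the induction hypothesis. The empty row is the square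
  with two identity sides.\<close>

lemma reverse_row_correct:
  assumes "b \<in> T" "is_path C T (src C b) as"
  shows "case fst (reverse_row (theta C S) b as) of
      None \<Rightarrow> \<not> (\<exists>h. b \<preceq> h \<and> path_prod C (src C b) as \<preceq> h)
    | Some (b', as') \<Rightarrow> b' \<in> T \<and> is_path C T (trg C b) as' \<and>
        lcm_square b (path_prod C (src C b) as) b' (path_prod C (trg C b) as')"
  using assms
proof (induction as arbitrary: b)
  case Nil
  then show ?case
    using lcm_square_idn T_Mor by (auto simp: ret_def)
next
  case (Cons a as)
  have a: "a \<in> T" "a \<in> Mor C" "src C a = src C b" and as: "is_path C T (trg C a) as"
    using Cons.prems by simp_all
  have prod: "path_prod C (trg C a) as \<in> Mor C" "src C (path_prod C (trg C a) as) = trg C a"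
    using path_prod_Mor[OF as] by simp_all
  show ?case
  proof (cases "theta C S a b")
    case None
    have "a \<preceq> h" if "a \<cdot> path_prod C (trg C a) as \<preceq> h" for h
      using rmultiple_trans[OF rmultipleI that] a prod by simp
    then show ?thesis
      using None theta_None[OF a(1) Cons.prems(1) None] by (auto simp: query_def)
  next
    case (Some b1)
    then obtain a1 where a1: "theta C S b a = Some a1" "a1 \<in> T" "b1 \<in> T" "lcm_square b a b1 a1"
      using theta_Some[OF a(1) Cons.prems(1)] by blast
    then have src: "src C b1 = trg C a" "src C a1 = trg C b" "trg C b1 = trg C a1"
      using lcm_square_trg[OF a1(4)] by (simp_all add: lcm_square_def)
    note IH = Cons.IH[OF a1(3), unfolded src, OF as]
    show ?thesis
    proof (cases "fst (reverse_row (theta C S) b1 as)")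
      case None
      have "\<not> (\<exists>h. b \<preceq> h \<and> a \<cdot> path_prod C (trg C a) as \<preceq> h)"
      proof
        assume "\<exists>h. b \<preceq> h \<and> a \<cdot> path_prod C (trg C a) as \<preceq> h"
        then obtain k where "b1 \<preceq> k" "path_prod C (trg C a) as \<preceq> k"
          using lcm_square_residual[OF a1(4) prod(1) prod(2)[symmetric]] by blast
        then show False
          using IH None by auto
      qed
      then show ?thesis
        using Some a1(1) None by (cases "reverse_row (theta C S) b1 as") (simp add: query_def)
    next
      case Some': (Some p)
      obtain b2 as2 where p: "p = (b2, as2)" by force
      have "b2 \<in> T" "is_path C T (trg C a1) as2"
        and "lcm_square b1 (path_prod C (trg C a) as) b2 (path_prod C (trg C a1) as2)"
        using IH Some' p by simp_all
      then show ?thesis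
        using Some a1 Some' p src lcm_square_paste[OF a1(4)] T_Mor[OF a1(2)]
        by (cases "reverse_row (theta C S) b1 as") (auto simp: query_def ret_def)
    qed
  qed
qed

text \<open>The grid is the stack of its rows, so the same two properties of squares apply, transposed:
  now the vertical side is the product that grows.\<close>

lemma reverse_grid_correct:
  assumes "is_path C T x bs" "is_path C T x as"
  shows "case fst (reverse_grid (theta C S) bs as) of
      None \<Rightarrow> \<not> (\<exists>h. path_prod C x bs \<preceq> h \<and> path_prod C x as \<preceq> h)
    | Some (as', bs') \<Rightarrow>
        is_path C T (trg C (path_prod C x bs)) as' \<and> is_path C T (trg C (path_prod C x as)) bs' \<and>
        lcm_square (path_prod C x bs) (path_prod C x as)
          (path_prod C (trg C (path_prod C x as)) bs') (path_prod C (trg C (path_prod C x bs)) as')"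
  using assms
proof (induction bs arbitrary: x as)
  case Nil
  then have "lcm_square (idn C x) (path_prod C x as)
      (idn C (trg C (path_prod C x as))) (path_prod C x as)"
    using lcm_square_idn[of "path_prod C x as"] path_prod_Mor[of T x as]
      lcm_square_commute by simp
  then show ?case
    using Nil path_prod_Mor[of T x as] by (simp add: ret_def)
next
  case (Cons b bs)
  have b: "b \<in> T" "b \<in> Mor C" "src C b = x" and bs: "is_path C T (trg C b) bs"
    using Cons.prems by simp_all
  have prod: "path_prod C (trg C b) bs \<in> Mor C" "src C (path_prod C (trg C b) bs) = trg C b"
    using path_prod_Mor[OF bs] by simp_all
  note row = reverse_row_correct[OF b(1), unfolded b(3), OF Cons.prems(2)]
  show ?case
  proof (cases "fst (reverse_row (theta C S) b as)")
    case None
    have "b \<preceq> h" if "b \<cdot> path_prod C (trg C b) bs \<preceq> h" for h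
      using rmultiple_trans[OF rmultipleI that] b prod by simp
    then show ?thesis
      using None row by (cases "reverse_row (theta C S) b as") auto
  next
    case (Some p)
    obtain b1 as1 where p: "p = (b1, as1)" by force
    have r: "b1 \<in> T" "is_path C T (trg C b) as1"
      "lcm_square b (path_prod C x as) b1 (path_prod C (trg C b) as1)"
      using row Some p by simp_all
    have sq: "lcm_square (path_prod C x as) b (path_prod C (trg C b) as1) b1"
      using r(3) lcm_square_commute by simp
    have src: "src C b1 = trg C (path_prod C x as)"
      "trg C b1 = trg C (path_prod C (trg C b) as1)"
      using r(3) lcm_square_trg[OF r(3)] by (simp_all add: lcm_square_def)
    note IH = Cons.IH[OF bs r(2)]
    show ?thesis
    proof (cases "fst (reverse_grid (theta C S) bs as1)")
      case None
      have "\<not> (\<exists>h. b \<cdot> path_prod C (trg C b) bs \<preceq> h \<and> path_prod C x as \<preceq> h)"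
      proof
        assume "\<exists>h. b \<cdot> path_prod C (trg C b) bs \<preceq> h \<and> path_prod C x as \<preceq> h"
        then obtain k where "path_prod C (trg C b) as1 \<preceq> k" "path_prod C (trg C b) bs \<preceq> k"
          using lcm_square_residual[OF sq prod(1) prod(2)[symmetric]] by blast
        then show False
          using IH None by auto
      qed
      then show ?thesis
        using Some p None
        by (cases "reverse_row (theta C S) b as"; cases "reverse_grid (theta C S) bs as1") simp
    next
      case Some': (Some q)
      obtain as2 bs2 where q: "q = (as2, bs2)" by force
      let ?A = "path_prod C (trg C b) as1" and ?B = "path_prod C (trg C b) bs"
      have i: "is_path C T (trg C ?B) as2" "is_path C T (trg C ?A) bs2"
        "lcm_square ?A ?B (path_prod C (trg C ?B) as2) (path_prod C (trg C ?A) bs2)"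
        using IH Some' q lcm_square_commute by simp_all
      have "lcm_square (b \<cdot> ?B) (path_prod C x as)
          (b1 \<cdot> path_prod C (trg C ?A) bs2) (path_prod C (trg C ?B) as2)"
        using lcm_square_paste[OF sq i(3)] lcm_square_commute by simp
      then show ?thesis
        using Some p Some' q i(1,2) r(1) b prod src T_Mor[OF r(1)]
        by (cases "reverse_row (theta C S) b as"; cases "reverse_grid (theta C S) bs as1")
          (simp add: ret_def)
    qed
  qed
qed

text \<open>A factorization of an identity consists of invertible elements, hence of identities.\<close>

lemma path_prod_eq_idn_imp_identities:
  assumes "is_path C A x w" "path_prod C x w = idn C x"
  shows "set w \<subseteq> identities C"
  using assms
proof (induction w arbitrary: x)
  case (Cons g w)
  then have g: "g \<in> Mor C" "src C g = x" "is_path C A (trg C g) w"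
    "g \<cdot> path_prod C (trg C g) w = idn C (src C g)"
    by simp_all
  then have ids: "g \<in> identities C" "path_prod C (trg C g) w \<in> identities C"
    using cmp_eq_idn[of g "path_prod C (trg C g) w"] path_prod_Mor[OF g(3)] by simp_all
  then have "path_prod C (trg C g) w = idn C (trg C g)"
    using identitiesD[OF ids(2)] path_prod_Mor[OF g(3)] by metis
  then show ?case
    using Cons.IH[OF g(3)] ids by simp
qed simp

lemma lcm_square_diagonal:
  assumes "lcm_square f f f' g'"
  shows "f' = idn C (trg C f) \<and> g' = idn C (trg C f)"
proof -
  have D: "f \<in> Mor C" "f' \<in> Mor C" "g' \<in> Mor C" "trg C f = src C f'" "trg C f = src C g'"
    "f \<cdot> g' = f \<cdot> f'" "f \<cdot> g' \<preceq> f" "f \<preceq> f \<cdot> g'"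
    using assms by (auto simp: lcm_square_def is_right_lcm_def rmultiple_refl)
  have "f \<cdot> g' = f \<cdot> idn C (trg C f)"
    using rmultiple_antisym[OF D(7,8)] D(1) by simp
  then show ?thesis
    using D left_cancel[of f g' "idn C (trg C f)"] left_cancel[of f f' "idn C (trg C f)"] by simp
qed

lemma drop_identities_empty_iff:
  "drop_identities C (map Pos as @ map Neg (rev bs)) = [] \<longleftrightarrow>
     set as \<subseteq> identities C \<and> set bs \<subseteq> identities C"
  by (auto simp: drop_identities_def filter_empty_conv)

lemma word_problem_II_correct:
  assumes "is_path C S x u" "is_path C S x v"
  shows "word_problem_II C S u v \<longleftrightarrow> path_prod C x u = path_prod C x v"
proof -
  let ?u = "path_prod C x u" and ?v = "path_prod C x v"
  have paths: "is_path C T x u" "is_path C T x v"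
    using assms is_path_mono[of S x _ T] by (auto simp: T_def)
  have Mor: "?u \<in> Mor C" "?v \<in> Mor C"
    using path_prod_Mor paths by blast+
  note grid = reverse_grid_correct[OF paths]
  show ?thesis
  proof (cases "fst (reverse_grid (theta C S) u v)")
    case None
    then have "?u \<noteq> ?v"
      using grid rmultiple_refl[OF Mor(2)] by auto
    moreover have "\<not> word_problem_II C S u v"
      using None unfolding word_problem_II_def right_reverse_def
      by (cases "reverse_grid (theta C S) u v") simp
    ultimately show ?thesis by simp
  next
    case (Some p)
    obtain as bs where p: "p = (as, bs)" by force
    have r: "is_path C T (trg C ?u) as" "is_path C T (trg C ?v) bs"
      "lcm_square ?u ?v (path_prod C (trg C ?v) bs) (path_prod C (trg C ?u) as)"
      using grid Some p by simp_all
    have "word_problem_II C S u v \<longleftrightarrow> set as \<subseteq> identities C \<and> set bs \<subseteq> identities C"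
      using Some p unfolding word_problem_II_def right_reverse_def
      by (cases "reverse_grid (theta C S) u v") (simp add: ret_def drop_identities_empty_iff)
    also have "\<dots> \<longleftrightarrow> path_prod C (trg C ?u) as = idn C (trg C ?u) \<and>
        path_prod C (trg C ?v) bs = idn C (trg C ?v)"
      using r(1,2) path_prod_identities path_prod_eq_idn_imp_identities by blast
    also have "\<dots> \<longleftrightarrow> ?u = ?v"
    proof
      assume "path_prod C (trg C ?u) as = idn C (trg C ?u) \<and>
        path_prod C (trg C ?v) bs = idn C (trg C ?v)"
      then show "?u = ?v"
        using r(3) Mor by (simp add: lcm_square_def)
    next
      assume "?u = ?v"
      then show "path_prod C (trg C ?u) as = idn C (trg C ?u) \<and>
        path_prod C (trg C ?v) bs = idn C (trg C ?v)"
        using r(3) lcm_square_diagonal by metis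
    qed
    finally show ?thesis .
  qed
qed

end

section \<open>Cost of the reversing grid\<close>

text \<open>The number of cells is bounded by the product of the input lengths because a successful
  row keeps its length; hence the second conjunct, which the induction on the number of rows needs.\<close>

lemma reverse_row_cost:
  "snd (reverse_row \<theta> b as) \<le> 2 * length as \<and>
   (\<forall>b' as'. fst (reverse_row \<theta> b as) = Some (b', as') \<longrightarrow> length as' = length as)"
proof (induction as arbitrary: b)
  case Nil
  then show ?case by (simp add: ret_def)
next
  case (Cons a as)
  show ?case
  proof (cases "\<theta> a b")
    case None
    then show ?thesis by (simp add: query_def)
  next
    case b': (Some b')
    show ?thesis
    proof (cases "\<theta> b a")
      case None
      then show ?thesis using b' by (simp add: query_def)
    next
      case (Some a')
      obtain r n where rn: "reverse_row \<theta> b' as = (r, n)" by force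
      show ?thesis
        using Cons.IH[of b'] b' Some rn by (cases r) (auto simp: query_def ret_def)
    qed
  qed
qed

lemma reverse_grid_cost: "snd (reverse_grid \<theta> bs as) \<le> 2 * length bs * length as"
proof (induction bs arbitrary: as)
  case Nil
  then show ?case by (simp add: ret_def)
next
  case (Cons b bs)
  obtain r n where rn: "reverse_row \<theta> b as = (r, n)" by force
  show ?case
  proof (cases r)
    case None
    then show ?thesis
      using reverse_row_cost[of \<theta> b as] rn by simp
  next
    case (Some p)
    obtain b' as' where p: "p = (b', as')" by force
    obtain r' n' where rn': "reverse_grid \<theta> bs as' = (r', n')" by force
    have "n \<le> 2 * length as" "n' \<le> 2 * length bs * length as"
      using reverse_row_cost[of \<theta> b as] Cons.IH[of as'] rn rn' Some p by simp_all
    then show ?thesis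
      using rn rn' Some p by (cases r') (auto simp: ret_def algebra_simps)
  qed
qed

lemma word_problem_II_cost_le: "word_problem_II_cost C S u v \<le> 2 * (length u + length v)\<^sup>2"
proof -
  have "word_problem_II_cost C S u v \<le> 2 * length u * length v"
    unfolding word_problem_II_cost_def right_reverse_def
    using reverse_grid_cost[of "theta C S" u v]
    by (cases "reverse_grid (theta C S) u v"; cases "fst (reverse_grid (theta C S) u v)")
      (auto simp: ret_def)
  also have "\<dots> \<le> 2 * (length u + length v)\<^sup>2"
    by (simp add: power2_eq_square algebra_simps)
  finally show ?thesis .
qed

theorem proposition4p17:
  fixes C :: "('o, 'm) partial_monoid" and S :: "'m set"
  assumes "left_cancellative_category C"
    and "garside_family C S"
    and "unique_local_right_lcms C"
  shows "(\<forall>x u v. is_path C S x u \<and> is_path C S x v \<longrightarrow>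
            (word_problem_II C S u v \<longleftrightarrow> path_prod C x u = path_prod C x v))
       \<and> (finite S \<longrightarrow>
            (\<exists>K. \<forall>x u v. is_path C S x u \<and> is_path C S x v \<longrightarrow>
               word_problem_II_cost C S u v \<le> K * (length u + length v)\<^sup>2))"
proof -
  interpret left_cancellative_category C by fact
  interpret lcm_garside C S
    using assms(2,3) by unfold_locales
  show ?thesis
    using word_problem_II_correct word_problem_II_cost_le by blast
qed

end
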